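(* Let $m \geq 3$ and let $T \in \mathbb{C}^m \otimes \mathbb{C}^m \otimes \mathbb{C}^m$ be a generic tensor of rank $m+1$. Then $\underline{\mathrm{R}}(T^{\otimes k}) = (\underline{\mathrm{R}}(T))^k$ for all $k \geq 1$. In particular, $\mathrm{R}^{\otimes}(T) = m+1$.
   Context: For a tensor $T \in V_1 \otimes \cdots \otimes V_\ell$ over $\mathbb{C}$, the tensor rank $\mathrm{R}(T)$ is the minimum $r$ such that $T = \sum_{i=1}^r v_1^{(i)} \otimes \cdots \otimes v_\ell^{(i)}$ with $v_j^{(i)} \in V_j$. The border rank $\underline{\mathrm{R}}(T)$ is the minimum $r$ such that $T = \lim_{\varepsilon \to 0} T_\varepsilon$ (Euclidean topology) with $\mathrm{R}(T_\varepsilon) = r$ for every $\varepsilon$. For $T$ of order $3$, $T^{\otimes k}$ is regarded as a tensor of order $3k$ (the factors are not grouped), and its rank and border rank are taken as an order-$3k$ tensor. The tensor asymptotic rank is $\mathrm{R}^{\otimes}(T) = \lim_{k \to \infty} [\mathrm{R}(T^{\otimes k})]^{1/k}$. "Generic tensor of rank $m+1$" means a tensor $T = \sum_{i=1}^{m+1} u_i \otimes v_i \otimes w_i$ for $(u_i,v_i,w_i)_{i=1}^{m+1}$ in some nonempty Zariski-open subset (depending only on $m$) of $(\mathbb{C}^m \times \mathbb{C}^m \times \mathbb{C}^m)^{m+1}$. *)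

theory Defs
  imports Complex_Main "HOL-Analysis.L2_Norm" "Jordan_Normal_Form.Matrix"
begin

section \<open>Tensors in coordinates\<close>

text \<open>
  An element of \<open>\<complex>\<^bsup>d1\<^esup> \<otimes> \<dots> \<otimes> \<complex>\<^bsup>dl\<^esup>\<close> is its coordinate array in the standard bases: a function
  on multi-indices (lists of length \<open>l\<close>, the \<open>i\<close>-th entry below the \<open>i\<close>-th dimension) that is
  \<open>0\<close> on all other lists, so that equality of tensors is equality of functions. The list \<open>ds\<close> of
  dimensions also records the order of the tensor. Since the order is not part of the type,
  the tensor powers of \<open>T\<close> for all \<open>k\<close> live in the same type.
\<close>

type_synonym tensor = "nat list \<Rightarrow> complex"

definition tensor_indices :: "nat list \<Rightarrow> nat list set" where
  "tensor_indices ds = {js. list_all2 (<) js ds}"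

definition tensor_space :: "nat list \<Rightarrow> tensor set" where
  "tensor_space ds = {T. \<forall>js. js \<notin> tensor_indices ds \<longrightarrow> T js = 0}"

definition pure_tensor :: "complex vec list \<Rightarrow> tensor" where
  "pure_tensor vs = (\<lambda>js. if js \<in> tensor_indices (map dim_vec vs)
                           then \<Prod>i<length vs. (vs ! i) $ (js ! i) else 0)"

definition sum_pure_tensors :: "complex vec list list \<Rightarrow> tensor" where
  "sum_pure_tensors vss = (\<lambda>js. \<Sum>vs\<leftarrow>vss. pure_tensor vs js)"

section \<open>Rank and border rank\<close>

definition tensor_rank :: "nat list \<Rightarrow> tensor \<Rightarrow> nat" where
  "tensor_rank ds T =
     (LEAST r. \<exists>vss. length vss = r \<and> (\<forall>vs\<in>set vss. map dim_vec vs = ds) \<and>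
                      T = sum_pure_tensors vss)"

text \<open>The limit is with respect to the Euclidean norm of the coordinate array.\<close>

definition border_rank :: "nat list \<Rightarrow> tensor \<Rightarrow> nat" where
  "border_rank ds T =
     (LEAST r. \<exists>F :: real \<Rightarrow> tensor.
        (\<forall>\<epsilon>>0. F \<epsilon> \<in> tensor_space ds \<and> tensor_rank ds (F \<epsilon>) = r) \<and>
        ((\<lambda>\<epsilon>. L2_set (\<lambda>js. cmod (F \<epsilon> js - T js)) (tensor_indices ds)) \<longlongrightarrow> 0) (at_right 0))"

section \<open>Tensor powers and tensor asymptotic rank\<close>

text \<open>
  The factors are not grouped: if \<open>S\<close> has dimensions \<open>ds\<close> and \<open>T\<close> has dimensions \<open>es\<close>, then
  their product has dimensions \<open>ds @ es\<close>.
\<close>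

definition tensor_product :: "nat list \<Rightarrow> tensor \<Rightarrow> tensor \<Rightarrow> tensor" where
  "tensor_product ds S T = (\<lambda>js. S (take (length ds) js) * T (drop (length ds) js))"

fun tensor_power :: "nat list \<Rightarrow> tensor \<Rightarrow> nat \<Rightarrow> tensor" where
  "tensor_power ds T 0 = (\<lambda>js. if js = [] then 1 else 0)"
| "tensor_power ds T (Suc k) = tensor_product ds T (tensor_power ds T k)"

definition power_dims :: "nat list \<Rightarrow> nat \<Rightarrow> nat list" where
  "power_dims ds k = concat (replicate k ds)"

text \<open>
  Stated as a relation, so that the existence of the limit is part of the assertion.
\<close>

definition has_tensor_asymptotic_rank :: "nat list \<Rightarrow> tensor \<Rightarrow> real \<Rightarrow> bool" where
  "has_tensor_asymptotic_rank ds T a \<longleftrightarrow>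
     (\<lambda>k. root k (real (tensor_rank (power_dims ds k) (tensor_power ds T k)))) \<longlonglongrightarrow> a"

section \<open>The parameter space and its Zariski topology\<close>

type_synonym vec_triple = "complex vec \<times> complex vec \<times> complex vec"

text \<open>The affine space \<open>(\<complex>\<^sup>m \<times> \<complex>\<^sup>m \<times> \<complex>\<^sup>m)\<^sup>r\<close>.\<close>

definition param_space :: "nat \<Rightarrow> nat \<Rightarrow> vec_triple list set" where
  "param_space m r =
     {ps. length ps = r \<and> set ps \<subseteq> carrier_vec m \<times> carrier_vec m \<times> carrier_vec m}"

definition tensor_of_params :: "vec_triple list \<Rightarrow> tensor" where
  "tensor_of_params ps = sum_pure_tensors (map (\<lambda>(u, v, w). [u, v, w]) ps)"

text \<open>The complex algebra of functions generated by the \<open>3 * m * r\<close> coordinates.\<close>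

inductive polynomial_map :: "nat \<Rightarrow> nat \<Rightarrow> (vec_triple list \<Rightarrow> complex) \<Rightarrow> bool"
  for m r :: nat where
  const: "polynomial_map m r (\<lambda>ps. c)"
| coord1: "i < r \<Longrightarrow> a < m \<Longrightarrow> polynomial_map m r (\<lambda>ps. fst (ps ! i) $ a)"
| coord2: "i < r \<Longrightarrow> a < m \<Longrightarrow> polynomial_map m r (\<lambda>ps. fst (snd (ps ! i)) $ a)"
| coord3: "i < r \<Longrightarrow> a < m \<Longrightarrow> polynomial_map m r (\<lambda>ps. snd (snd (ps ! i)) $ a)"
| add: "polynomial_map m r f \<Longrightarrow> polynomial_map m r g \<Longrightarrow> polynomial_map m r (\<lambda>ps. f ps + g ps)"
| mult: "polynomial_map m r f \<Longrightarrow> polynomial_map m r g \<Longrightarrow> polynomial_map m r (\<lambda>ps. f ps * g ps)"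

definition zariski_open :: "nat \<Rightarrow> nat \<Rightarrow> vec_triple list set \<Rightarrow> bool" where
  "zariski_open m r U \<longleftrightarrow>
     (\<exists>P. (\<forall>f\<in>P. polynomial_map m r f) \<and> U = {ps \<in> param_space m r. \<exists>f\<in>P. f ps \<noteq> 0})"

end

theory Submission
  imports Defs "Jordan_Normal_Form.Determinant"
begin

text \<open>
  The upper bound is formal: \<open>T\<close> is a sum of \<open>m + 1\<close> pure tensors, expanding the product writes
  \<open>T\<^sup>\<otimes>\<^sup>k\<close> as a sum of \<open>(m + 1)\<^sup>k\<close> pure tensors, and the border rank is at most the rank.

  The lower bound comes from a linear map to matrices that is compatible with tensor products. Use
  only the first three coordinates of the first factor, and send \<open>u \<otimes> v \<otimes> w\<close> to \<open>K(u) \<otimes> v w\<^sup>t\<close>,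
  where \<open>K(u)\<close> is the skew \<open>3 \<times> 3\<close> matrix of the cross product with \<open>u\<close>. This is the Koszul
  flattening of Strassen's equations. Since \<open>K(u)\<close> has rank at most \<open>2\<close>, so does the image of every
  pure tensor of order three. Its Kronecker power sends every pure tensor of order \<open>3 * k\<close>,
  whose factors need not be grouped in any way, to a matrix of rank at most \<open>2\<^sup>k\<close>
  (\<open>rank_flattening_power_pure_tensor\<close>).

  Suppose that some minor of size \<open>2 * m + 2\<close> of the flattening of \<open>T\<close> does not vanish. After
  multiplication by an inverse matrix the corresponding block is the identity, and the block of its
  Kronecker power at \<open>T\<^sup>\<otimes>\<^sup>k\<close> is the identity of size \<open>(2 * m + 2)\<^sup>k\<close>. A matrix close to the identity has
  full rank (\<open>rank_near_identity\<close>), so a tensor close to \<open>T\<^sup>\<otimes>\<^sup>k\<close> of rank \<open>r\<close> satisfies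
  \<open>(2 * m + 2)\<^sup>k \<le> r * 2\<^sup>k\<close>, that is \<open>(m + 1)\<^sup>k \<le> r\<close> (\<open>border_rank_tensor_power_ge\<close>). Hence rank and
  border rank of \<open>T\<^sup>\<otimes>\<^sup>k\<close> are both \<open>(m + 1)\<^sup>k\<close>, which contains both assertions.

  The minor is a polynomial in the vectors \<open>u\<^sub>l, v\<^sub>l, w\<^sub>l\<close>, so its nonvanishing defines a Zariski-open
  set. This set is not empty because the minor is nonzero for the tensor
  \<open>\<Sum>\<^sub>l e\<^bsub>min l 2\<^esub> \<otimes> e\<^sub>l \<otimes> e\<^sub>l + e\<^sub>2 \<otimes> (e\<^sub>0 + e\<^sub>1) \<otimes> (e\<^sub>0 + e\<^sub>1)\<close> (\<open>koszul_minor_special_params\<close>). The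
  assumption \<open>m \<ge> 3\<close> provides the three coordinates of the first factor.
\<close>

section \<open>Matrices of bounded rank\<close>

text \<open>
  A homogeneous linear system with more unknowns than equations has a nontrivial solution, by
  elimination of one unknown with the first equation in which some coefficient is nonzero.
\<close>

lemma nontrivial_common_zero:
  fixes qs :: "('i \<Rightarrow> 'f::field) list"
  assumes "finite A" "length qs < card A"
  shows "\<exists>x. (\<exists>i\<in>A. x i \<noteq> 0) \<and> (\<forall>q\<in>set qs. (\<Sum>j\<in>A. q j * x j) = 0)"
  using assms
proof (induction "length qs" arbitrary: qs A)
  case 0
  then have "A \<noteq> {}" by auto
  then show ?case using 0 by (intro exI[of _ "\<lambda>_. 1"]) auto
next
  case (Suc n)
  then obtain q rs where qs: "qs = q # rs" and n: "n = length rs" by (cases qs) auto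
  show ?case
  proof (cases "\<forall>j\<in>A. q j = 0")
    case True
    with Suc.hyps(1)[OF n, of A] Suc.prems show ?thesis
      unfolding qs by (auto simp: sum.neutral)
  next
    case False
    then obtain j0 where j0: "j0 \<in> A" "q j0 \<noteq> 0" by auto
    let ?B = "A - {j0}"
    let ?red = "\<lambda>r j. r j - r j0 * q j / q j0"
    have "n = length (map ?red rs)" "finite ?B" "length (map ?red rs) < card ?B"
      using Suc.prems j0 by (auto simp: qs n)
    from Suc.hyps(1)[OF this] obtain x where
      x: "\<exists>i\<in>?B. x i \<noteq> 0" and zero: "\<And>r. r \<in> set rs \<Longrightarrow> (\<Sum>j\<in>?B. ?red r j * x j) = 0"
      by auto
    \<comment> \<open>the equation \<open>q\<close> determines the value at \<open>j0\<close> from the other values\<close>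
    define s where "s = (\<Sum>j\<in>?B. q j * x j)"
    define y where "y = x(j0 := - s / q j0)"
    have split: "(\<Sum>j\<in>A. r j * y j) = r j0 * (- s / q j0) + (\<Sum>j\<in>?B. r j * x j)" for r
    proof -
      have "(\<Sum>j\<in>A. r j * y j) = r j0 * y j0 + (\<Sum>j\<in>?B. r j * y j)"
        using Suc.prems j0 by (simp add: sum.remove)
      also have "(\<Sum>j\<in>?B. r j * y j) = (\<Sum>j\<in>?B. r j * x j)"
        by (rule sum.cong) (auto simp: y_def)
      finally show ?thesis by (simp add: y_def)
    qed
    have "(\<Sum>j\<in>A. q j * y j) = 0"
      unfolding split using j0 by (simp add: s_def)
    moreover have "(\<Sum>j\<in>A. r j * y j) = 0" if "r \<in> set rs" for r
    proof -
      have "(\<Sum>j\<in>?B. ?red r j * x j) = (\<Sum>j\<in>?B. r j * x j) - r j0 / q j0 * s"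
        unfolding s_def sum_distrib_left sum_subtractf[symmetric]
        by (rule sum.cong) (auto simp: algebra_simps)
      with zero[OF that] show ?thesis unfolding split by simp
    qed
    moreover have "\<exists>i\<in>A. y i \<noteq> 0" using x by (auto simp: y_def)
    ultimately show ?thesis unfolding qs by (intro exI[of _ y]) auto
  qed
qed

text \<open>
  The matrix has a factorization with inner dimension \<open>r\<close>: the pairs \<open>(p, q)\<close> are the columns of
  the left factor and the rows of the right factor. A list of pairs turns sums of matrices into
  concatenation and Kronecker products into \<open>List.product\<close>, in the same way as lists of pure tensors
  behave under sums and products of tensors.
\<close>

definition rank_at_most :: "nat \<Rightarrow> 'i set \<Rightarrow> ('i \<Rightarrow> 'i \<Rightarrow> complex) \<Rightarrow> bool" where
  "rank_at_most r A f \<longleftrightarrow>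
     (\<exists>pqs. length pqs = r \<and> (\<forall>i\<in>A. \<forall>j\<in>A. f i j = (\<Sum>(p, q)\<leftarrow>pqs. p i * q j)))"

lemma rank_at_most_cong:
  assumes "\<And>i j. i \<in> A \<Longrightarrow> j \<in> A \<Longrightarrow> f i j = h i j"
  shows "rank_at_most r A f \<longleftrightarrow> rank_at_most r A h"
  using assms by (simp add: rank_at_most_def)

lemma rank_at_most_add:
  assumes "rank_at_most r A f" "rank_at_most s A h"
  shows "rank_at_most (r + s) A (\<lambda>i j. f i j + h i j)"
proof -
  obtain ps qs where "length ps = r" "\<forall>i\<in>A. \<forall>j\<in>A. f i j = (\<Sum>(p, q)\<leftarrow>ps. p i * q j)"
    "length qs = s" "\<forall>i\<in>A. \<forall>j\<in>A. h i j = (\<Sum>(p, q)\<leftarrow>qs. p i * q j)"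
    using assms unfolding rank_at_most_def by blast
  then show ?thesis unfolding rank_at_most_def by (intro exI[of _ "ps @ qs"]) auto
qed

lemma rank_at_most_sum_list:
  assumes "\<And>v. v \<in> set vs \<Longrightarrow> rank_at_most r A (f v)"
  shows "rank_at_most (length vs * r) A (\<lambda>i j. \<Sum>v\<leftarrow>vs. f v i j)"
  using assms
proof (induction vs)
  case Nil
  then show ?case by (auto simp: rank_at_most_def)
next
  case (Cons v vs)
  then show ?case using rank_at_most_add[of r A "f v"] by simp
qed

lemma rank_at_most_mult_left:
  assumes "rank_at_most r A f" "finite A"
  shows "rank_at_most r A (\<lambda>i j. \<Sum>l\<in>A. c i l * f l j)"
proof -
  obtain ps where ps: "length ps = r" "\<forall>i\<in>A. \<forall>j\<in>A. f i j = (\<Sum>(p, q)\<leftarrow>ps. p i * q j)"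
    using assms unfolding rank_at_most_def by blast
  have "(\<Sum>l\<in>A. c i l * f l j) =
        (\<Sum>(p, q)\<leftarrow>map (\<lambda>(p, q). (\<lambda>i. \<Sum>l\<in>A. c i l * p l, q)) ps. p i * q j)"
    if "j \<in> A" for i j
  proof -
    have "(\<Sum>l\<in>A. c i l * f l j) = (\<Sum>l\<in>A. c i l * (\<Sum>(p, q)\<leftarrow>ps. p l * q j))"
      using ps that by (intro sum.cong) auto
    also have "\<dots> = (\<Sum>(p, q)\<leftarrow>ps. (\<Sum>l\<in>A. c i l * p l) * q j)"
      by (induction ps) (auto simp: distrib_left sum.distrib sum_distrib_left sum_distrib_right ac_simps)
    finally show ?thesis by (simp add: case_prod_unfold o_def)
  qed
  then show ?thesis unfolding rank_at_most_def
    by (intro exI[of _ "map (\<lambda>(p, q). (\<lambda>i. \<Sum>l\<in>A. c i l * p l, q)) ps"]) (simp add: ps)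
qed

text \<open>
  A linear relation between the rows allows one of them to be replaced by a combination of the others.
\<close>

lemma rank_at_most_row_relation:
  assumes "finite A" "r \<in> A" "c r \<noteq> 0"
    and rel: "\<And>j. j \<in> A \<Longrightarrow> (\<Sum>i\<in>A. c i * f i j) = 0"
  shows "rank_at_most (card A - 1) A f"
proof -
  obtain xs where xs: "set xs = A - {r}" "distinct xs"
    using finite_distinct_list[of "A - {r}"] \<open>finite A\<close> by auto
  let ?p = "\<lambda>l i. if i = l then 1 else if i = r then - c l / c r else 0"
  have "f i j = (\<Sum>l\<in>A - {r}. ?p l i * f l j)" if "i \<in> A" "j \<in> A" for i j
  proof (cases "i = r")
    case True
    have "c r * f r j = - (\<Sum>l\<in>A - {r}. c l * f l j)"
      using rel[OF that(2)] assms(1,2) by (simp add: sum.remove eq_neg_iff_add_eq_0)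
    then have "f r j = - (\<Sum>l\<in>A - {r}. c l * f l j) / c r"
      using \<open>c r \<noteq> 0\<close> by (simp add: field_simps)
    also have "\<dots> = (\<Sum>l\<in>A - {r}. - c l / c r * f l j)"
      by (simp add: sum_negf sum_divide_distrib)
    also have "\<dots> = (\<Sum>l\<in>A - {r}. ?p l r * f l j)"
      by (intro sum.cong) auto
    finally show ?thesis unfolding True .
  next
    case False
    have "(\<Sum>l\<in>A - {r}. ?p l i * f l j) = (\<Sum>l\<in>A - {r}. if i = l then f l j else 0)"
      using False by (intro sum.cong) auto
    then show ?thesis using False that \<open>finite A\<close> by simp
  qed
  moreover have "length xs = card A - 1"
    using xs \<open>r \<in> A\<close> \<open>finite A\<close> distinct_card[of xs] by simp
  ultimately show ?thesis unfolding rank_at_most_def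
    by (intro exI[of _ "map (\<lambda>l. (?p l, f l)) xs"])
       (simp add: o_def xs sum_list_distinct_conv_sum_set)
qed

text \<open>
  The rows and the columns of a \<open>k\<close>-th Kronecker power are indexed by words of length \<open>k\<close>.
\<close>

definition words :: "'i set \<Rightarrow> nat \<Rightarrow> 'i list set" where
  "words A k = {is. set is \<subseteq> A \<and> length is = k}"

lemma finite_words: "finite A \<Longrightarrow> finite (words A k)"
  unfolding words_def by (rule finite_lists_length_eq)

lemma card_words: "finite A \<Longrightarrow> card (words A k) = card A ^ k"
  unfolding words_def by (rule card_lists_length_eq)

lemma words_0: "words A 0 = {[]}"
  by (auto simp: words_def)

lemma words_Suc: "is \<in> words A (Suc k) \<longleftrightarrow> (\<exists>i is'. is = i # is' \<and> i \<in> A \<and> is' \<in> words A k)"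
  by (auto simp: words_def length_Suc_conv)

lemma rank_at_most_kronecker:
  assumes "rank_at_most r A f" "rank_at_most s (words A k) h"
  shows "rank_at_most (r * s) (words A (Suc k)) (\<lambda>is js. f (hd is) (hd js) * h (tl is) (tl js))"
proof -
  obtain ps qs where ps: "length ps = r" "\<forall>i\<in>A. \<forall>j\<in>A. f i j = (\<Sum>(p, q)\<leftarrow>ps. p i * q j)"
    and qs: "length qs = s" "\<forall>i\<in>words A k. \<forall>j\<in>words A k. h i j = (\<Sum>(p, q)\<leftarrow>qs. p i * q j)"
    using assms unfolding rank_at_most_def by blast
  let ?pqs = "map (\<lambda>((p, q), (p', q')). (\<lambda>is. p (hd is) * p' (tl is), \<lambda>js. q (hd js) * q' (tl js)))
                (List.product ps qs)"
  have *: "(\<Sum>(p, q)\<leftarrow>ps. p i * q j) * (\<Sum>(p, q)\<leftarrow>qs. p rs * q cs) =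
        (\<Sum>(p, q)\<leftarrow>?pqs. p (i # rs) * q (j # cs))" for i j rs cs
  proof (induction ps)
    case (Cons pq ps)
    have "fst pq i * snd pq j * (\<Sum>(p, q)\<leftarrow>qs. p rs * q cs) =
          (\<Sum>(p, q)\<leftarrow>qs. fst pq i * p rs * (snd pq j * q cs))"
      by (simp add: case_prod_unfold sum_list_const_mult[symmetric] ac_simps)
    with Cons show ?case by (simp add: distrib_right o_def case_prod_unfold)
  qed simp
  show ?thesis unfolding rank_at_most_def
    by (rule exI[of _ ?pqs])
       (use * in \<open>auto simp: ps qs words_Suc\<close>)
qed

text \<open>
  Such a matrix is strictly diagonally dominant and therefore has trivial kernel, whereas a
  factorization with fewer than \<open>card A\<close> pairs leaves a nonzero common zero of the right factors.
\<close>

lemma rank_near_identity: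
  assumes "finite A" and "rank_at_most r A f"
    and close: "\<And>i j. i \<in> A \<Longrightarrow> j \<in> A \<Longrightarrow> cmod (f i j - (if i = j then 1 else 0)) < 1 / card A"
  shows "card A \<le> r"
proof (rule ccontr)
  assume "\<not> card A \<le> r"
  obtain pqs where len: "length pqs = r"
    and f: "\<forall>i\<in>A. \<forall>j\<in>A. f i j = (\<Sum>(p, q)\<leftarrow>pqs. p i * q j)"
    using assms unfolding rank_at_most_def by blast
  then obtain x where x: "\<exists>i\<in>A. x i \<noteq> 0"
    and zero: "\<And>q. q \<in> set (map snd pqs) \<Longrightarrow> (\<Sum>j\<in>A. q j * x j) = 0"
    using nontrivial_common_zero[of A "map snd pqs"] \<open>\<not> card A \<le> r\<close> \<open>finite A\<close> by auto
  have kernel: "(\<Sum>j\<in>A. f i j * x j) = 0" if "i \<in> A" for i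
  proof -
    have "(\<Sum>j\<in>A. f i j * x j) = (\<Sum>j\<in>A. (\<Sum>(p, q)\<leftarrow>pqs. p i * q j) * x j)"
      using f that by (intro sum.cong) auto
    also have "\<dots> = (\<Sum>(p, q)\<leftarrow>pqs. p i * (\<Sum>j\<in>A. q j * x j))"
      by (induction pqs) (auto simp: algebra_simps sum.distrib sum_distrib_left)
    also have "\<dots> = (\<Sum>(p, q)\<leftarrow>pqs. 0)"
      using zero by (intro arg_cong[of _ _ sum_list] map_cong) force+
    finally show ?thesis by (simp add: case_prod_unfold)
  qed
  \<comment> \<open>the row of an entry of \<open>x\<close> of largest modulus is violated\<close>
  define a where "a = Max ((\<lambda>i. cmod (x i)) ` A)"
  have "A \<noteq> {}" using x by auto
  then have "a \<in> (\<lambda>i. cmod (x i)) ` A"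
    unfolding a_def using \<open>finite A\<close> by (intro Max_in) auto
  then obtain i where i: "i \<in> A" "cmod (x i) = a" by auto
  have le: "cmod (x j) \<le> a" if "j \<in> A" for j
    using that \<open>finite A\<close> by (auto simp: a_def)
  then have "a > 0" using x by (metis zero_less_norm_iff less_le_trans)
  have "x i = (\<Sum>j\<in>A. (if i = j then 1 else 0) * x j)"
    using i \<open>finite A\<close> by (simp add: if_distrib[of "\<lambda>c. c * _"] cong: if_cong)
  also have "\<dots> = (\<Sum>j\<in>A. ((if i = j then 1 else 0) - f i j) * x j)"
    using kernel[OF i(1)] by (simp add: left_diff_distrib sum_subtractf)
  finally have "a \<le> (\<Sum>j\<in>A. cmod (((if i = j then 1 else 0) - f i j) * x j))"
    using i(2) norm_sum by metis
  also have "\<dots> < (\<Sum>j\<in>A. 1 / card A * a)"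
  proof (rule sum_strict_mono)
    fix j assume "j \<in> A"
    have "cmod ((if i = j then 1 else 0) - f i j) * cmod (x j)
       \<le> cmod ((if i = j then 1 else 0) - f i j) * a"
      using le[OF \<open>j \<in> A\<close>] by (intro mult_left_mono) auto
    also have "\<dots> < 1 / card A * a"
      using close[OF i(1) \<open>j \<in> A\<close>] \<open>a > 0\<close>
      by (intro mult_strict_right_mono) (auto simp: norm_minus_commute)
    finally show "cmod (((if i = j then 1 else 0) - f i j) * x j) < 1 / card A * a"
      by (simp add: norm_mult)
  qed (use \<open>finite A\<close> \<open>A \<noteq> {}\<close> in auto)
  also have "\<dots> = a" using \<open>finite A\<close> \<open>A \<noteq> {}\<close> by simp
  finally show False by simp
qed

section \<open>Pure tensors, rank and border rank\<close>

lemma tensor_indices_Nil: "tensor_indices [] = {[]}"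
  by (auto simp: tensor_indices_def)

lemma tensor_indices_Cons:
  "tensor_indices (d # ds) = (\<lambda>(a, x). a # x) ` ({..<d} \<times> tensor_indices ds)"
  by (auto simp: tensor_indices_def list_all2_Cons2 image_iff)

lemma finite_tensor_indices: "finite (tensor_indices ds)"
  by (induction ds) (auto simp: tensor_indices_Nil tensor_indices_Cons)

lemma length_tensor_indices: "x \<in> tensor_indices ds \<Longrightarrow> length x = length ds"
  by (auto simp: tensor_indices_def list_all2_lengthD)

lemma append_in_tensor_indices:
  "length x = length ds \<Longrightarrow>
     x @ y \<in> tensor_indices (ds @ es) \<longleftrightarrow> x \<in> tensor_indices ds \<and> y \<in> tensor_indices es"
  by (auto simp: tensor_indices_def list_all2_append)

lemma tensor_power_1:
  assumes "T \<in> tensor_space ds"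
  shows "tensor_power ds T 1 = T"
proof
  fix js
  show "tensor_power ds T 1 js = T js"
  proof (cases "length js \<le> length ds")
    case True
    then show ?thesis by (simp add: tensor_product_def)
  next
    case False
    then have "js \<notin> tensor_indices ds" using length_tensor_indices by force
    then show ?thesis using False assms by (simp add: tensor_product_def tensor_space_def)
  qed
qed

lemma prod_split_lessThan:
  fixes f :: "nat \<Rightarrow> 'a::comm_monoid_mult"
  shows "(\<Prod>i<m + n. f i) = (\<Prod>i<m. f i) * (\<Prod>i<n. f (m + i))"
  by (induction n) (simp_all add: ac_simps)

lemma pure_tensor_append:
  assumes "length x = length us"
  shows "pure_tensor (us @ vs) (x @ y) = pure_tensor us x * pure_tensor vs y"
proof -
  have "(\<Prod>i<length us + length vs. ((us @ vs) ! i) $ ((x @ y) ! i)) =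
        (\<Prod>i<length us. (us ! i) $ (x ! i)) * (\<Prod>i<length vs. (vs ! i) $ (y ! i))"
    using assms
    by (subst prod_split_lessThan) (auto simp: nth_append intro!: arg_cong2[of _ _ _ _ "(*)"] prod.cong)
  then show ?thesis
    using assms by (auto simp: pure_tensor_def append_in_tensor_indices)
qed

lemma sum_pure_tensors_in_space:
  "\<forall>vs\<in>set vss. map dim_vec vs = ds \<Longrightarrow> sum_pure_tensors vss \<in> tensor_space ds"
  by (induction vss) (auto simp: tensor_space_def sum_pure_tensors_def pure_tensor_def)

lemma pure_tensor_short: "length js \<noteq> length vs \<Longrightarrow> pure_tensor vs js = 0"
  by (auto simp: pure_tensor_def dest: length_tensor_indices)

lemma sum_pure_tensors_append:
  "sum_pure_tensors (vss @ wss) js = sum_pure_tensors vss js + sum_pure_tensors wss js"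
  by (simp add: sum_pure_tensors_def)

lemma tensor_product_pure_tensor:
  assumes "map dim_vec us = ds"
  shows "tensor_product ds (pure_tensor us) (pure_tensor vs) = pure_tensor (us @ vs)"
proof
  fix js
  have len: "length us = length ds" using assms by auto
  show "tensor_product ds (pure_tensor us) (pure_tensor vs) js = pure_tensor (us @ vs) js"
  proof (cases "length js < length ds")
    case True
    then show ?thesis using len by (simp add: tensor_product_def pure_tensor_short)
  next
    case False
    then show ?thesis
      using pure_tensor_append[of "take (length ds) js" us vs "drop (length ds) js"] len
      by (simp add: tensor_product_def)
  qed
qed

definition has_decomposition :: "nat list \<Rightarrow> tensor \<Rightarrow> nat \<Rightarrow> bool" where
  "has_decomposition ds T r \<longleftrightarrow>
     (\<exists>vss. length vss = r \<and> (\<forall>vs\<in>set vss. map dim_vec vs = ds) \<and> T = sum_pure_tensors vss)"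

lemma tensor_rank_eq_Least: "tensor_rank ds T = (LEAST r. has_decomposition ds T r)"
  by (simp add: tensor_rank_def has_decomposition_def)

lemma has_decomposition_in_space: "has_decomposition ds T r \<Longrightarrow> T \<in> tensor_space ds"
  by (auto simp: has_decomposition_def intro: sum_pure_tensors_in_space)

lemma has_decomposition_product:
  assumes "has_decomposition ds S r" "has_decomposition es T s"
  shows "has_decomposition (ds @ es) (tensor_product ds S T) (r * s)"
proof -
  obtain uss vss where u: "length uss = r" "\<forall>vs\<in>set uss. map dim_vec vs = ds" "S = sum_pure_tensors uss"
    and v: "length vss = s" "\<forall>vs\<in>set vss. map dim_vec vs = es" "T = sum_pure_tensors vss"
    using assms unfolding has_decomposition_def by blast
  let ?wss = "map (\<lambda>(us, vs). us @ vs) (List.product uss vss)"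
  have "tensor_product ds (sum_pure_tensors uss) (sum_pure_tensors vss) js =
        sum_pure_tensors (map (\<lambda>(us, vs). us @ vs) (List.product uss vss)) js"
    if "\<forall>vs\<in>set uss. map dim_vec vs = ds" for uss js
    using that
  proof (induction uss)
    case Nil
    then show ?case by (simp add: tensor_product_def sum_pure_tensors_def)
  next
    case (Cons us uss)
    have "pure_tensor us (take (length ds) js) * sum_pure_tensors vss (drop (length ds) js) =
          (\<Sum>vs\<leftarrow>vss. tensor_product ds (pure_tensor us) (pure_tensor vs) js)"
      by (simp add: tensor_product_def sum_pure_tensors_def sum_list_const_mult)
    also have "\<dots> = (\<Sum>vs\<leftarrow>vss. pure_tensor (us @ vs) js)"
      using Cons.prems by (simp add: tensor_product_pure_tensor)
    finally show ?case using Cons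
      by (simp add: tensor_product_def sum_pure_tensors_def distrib_right o_def case_prod_unfold)
  qed
  then have "tensor_product ds S T = sum_pure_tensors ?wss" using u v by (intro ext) simp
  then show ?thesis unfolding has_decomposition_def
    by (intro exI[of _ ?wss]) (use u v in auto)
qed

lemma has_decomposition_power:
  assumes "has_decomposition ds T r"
  shows "has_decomposition (power_dims ds k) (tensor_power ds T k) (r ^ k)"
proof (induction k)
  case 0
  have "tensor_power ds T 0 = sum_pure_tensors [[]]"
    by (auto simp: sum_pure_tensors_def pure_tensor_def tensor_indices_Nil)
  then show ?case unfolding has_decomposition_def
    by (intro exI[of _ "[[]]"]) (simp add: power_dims_def)
next
  case (Suc k)
  then show ?case using has_decomposition_product[OF assms Suc] by (simp add: power_dims_def)
qed

text \<open>
  Cut the tensor into its slices along the first index and decompose each of them by induction. The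
  list of dimensions must not be empty: in order \<open>0\<close> a sum of pure tensors is a natural number.
\<close>

lemma has_decomposition_exists:
  assumes "ds \<noteq> []" "T \<in> tensor_space ds"
  shows "\<exists>r. has_decomposition ds T r"
  using assms
proof (induction ds arbitrary: T rule: list_nonempty_induct)
  case (single d)
  have "T = pure_tensor [vec d (\<lambda>a. T [a])]"
  proof
    fix js
    show "T js = pure_tensor [vec d (\<lambda>a. T [a])] js"
      using single by (cases "js \<in> tensor_indices [d]")
        (auto simp: pure_tensor_def tensor_space_def tensor_indices_Cons tensor_indices_Nil)
  qed
  then show ?case unfolding has_decomposition_def
    by (intro exI[of _ 1] exI[of _ "[[vec d (\<lambda>a. T [a])]]"]) (simp add: sum_pure_tensors_def)
next
  case (cons d ds)
  have "\<exists>vss. (\<forall>vs\<in>set vss. map dim_vec vs = ds) \<and> (\<lambda>x. T (a # x)) = sum_pure_tensors vss" for a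
  proof -
    have "(\<lambda>x. T (a # x)) \<in> tensor_space ds"
      using cons.prems by (auto simp: tensor_space_def tensor_indices_Cons image_iff)
    from cons.IH[OF this] show ?thesis by (auto simp: has_decomposition_def)
  qed
  then obtain V where dims: "\<And>a vs. vs \<in> set (V a) \<Longrightarrow> map dim_vec vs = ds"
    and V: "\<And>a x. T (a # x) = sum_pure_tensors (V a) x"
    by (metis (no_types, lifting))
  let ?W = "\<lambda>a. map (\<lambda>vs. unit_vec d a # vs) (V a)"
  have unit: "pure_tensor (unit_vec d a # vs) (b # x) = (if b = a then pure_tensor vs x else 0)"
    if "b < d" for a b :: nat and vs x
    using that pure_tensor_append[of "[b]" "[unit_vec d a]" vs x]
    by (auto simp: pure_tensor_def tensor_indices_Cons tensor_indices_Nil unit_vec_def)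
  have slice: "sum_pure_tensors (?W a) (b # x) = (if b = a then T (b # x) else 0)" if "b < d" for a b x
    using that by (simp add: V sum_pure_tensors_def o_def unit)
  have sums: "sum_pure_tensors (concat (map ?W [0..<n])) (b # x) = (if b < n then T (b # x) else 0)"
    if "b < d" for n b x
    by (induction n) (auto simp: sum_pure_tensors_append slice[OF that], auto simp: sum_pure_tensors_def)
  let ?vss = "concat (map ?W [0..<d])"
  have W: "\<forall>vs\<in>set ?vss. map dim_vec vs = d # ds" using dims by auto
  have "T js = sum_pure_tensors ?vss js" for js
  proof (cases "js \<in> tensor_indices (d # ds)")
    case True
    then show ?thesis using sums[where n = d] by (auto simp: tensor_indices_Cons)
  next
    case False
    then show ?thesis
      using cons.prems sum_pure_tensors_in_space[OF W] by (simp add: tensor_space_def)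
  qed
  then show ?case using W unfolding has_decomposition_def by blast
qed

text \<open>
  The least number in the definition of the rank is attained, because some decomposition exists.
\<close>

lemma tensor_rank_decomposition:
  assumes "ds \<noteq> []" "T \<in> tensor_space ds"
  shows "has_decomposition ds T (tensor_rank ds T)"
  unfolding tensor_rank_eq_Least using has_decomposition_exists[OF assms] by (rule LeastI_ex)

lemma tensor_rank_le: "has_decomposition ds T r \<Longrightarrow> tensor_rank ds T \<le> r"
  unfolding tensor_rank_eq_Least by (rule Least_le)

lemma border_rank_le_tensor_rank:
  assumes "T \<in> tensor_space ds"
  shows "border_rank ds T \<le> tensor_rank ds T"
  unfolding border_rank_def
  by (rule Least_le, rule exI[of _ "\<lambda>_. T"]) (use assms in \<open>simp add: L2_set_def\<close>)

text \<open>
  The least number in the definition of the border rank is attained, because the constant family \<open>T\<close>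
  is admissible. Convergence in the Euclidean norm gives convergence of each coordinate, which is the form
  that linear maps need.
\<close>

lemma border_rank_approximation:
  assumes "T \<in> tensor_space ds"
  obtains F :: "real \<Rightarrow> tensor"
  where "\<And>\<epsilon>. \<epsilon> > 0 \<Longrightarrow> F \<epsilon> \<in> tensor_space ds \<and> tensor_rank ds (F \<epsilon>) = border_rank ds T"
    and "\<And>js. js \<in> tensor_indices ds \<Longrightarrow> ((\<lambda>\<epsilon>. F \<epsilon> js) \<longlongrightarrow> T js) (at_right 0)"
proof -
  let ?P = "\<lambda>r. \<exists>F :: real \<Rightarrow> tensor.
        (\<forall>\<epsilon>>0. F \<epsilon> \<in> tensor_space ds \<and> tensor_rank ds (F \<epsilon>) = r) \<and>
        ((\<lambda>\<epsilon>. L2_set (\<lambda>js. cmod (F \<epsilon> js - T js)) (tensor_indices ds)) \<longlongrightarrow> 0) (at_right 0)"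
  have "?P (tensor_rank ds T)"
    by (rule exI[of _ "\<lambda>_. T"]) (use assms in \<open>simp add: L2_set_def\<close>)
  then have "?P (border_rank ds T)"
    unfolding border_rank_def by (rule LeastI)
  then obtain F :: "real \<Rightarrow> tensor" where
    F: "\<forall>\<epsilon>>0. F \<epsilon> \<in> tensor_space ds \<and> tensor_rank ds (F \<epsilon>) = border_rank ds T" and
    lim: "((\<lambda>\<epsilon>. L2_set (\<lambda>js. cmod (F \<epsilon> js - T js)) (tensor_indices ds)) \<longlongrightarrow> 0) (at_right 0)"
    by blast
  have "((\<lambda>\<epsilon>. F \<epsilon> js) \<longlongrightarrow> T js) (at_right 0)" if "js \<in> tensor_indices ds" for js
  proof -
    have "cmod (F \<epsilon> js - T js) \<le> L2_set (\<lambda>js. cmod (F \<epsilon> js - T js)) (tensor_indices ds)" for \<epsilon>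
      using member_le_L2_set[OF finite_tensor_indices that, of "\<lambda>js. cmod (F \<epsilon> js - T js)"] by simp
    then have "((\<lambda>\<epsilon>. F \<epsilon> js - T js) \<longlongrightarrow> 0) (at_right 0)"
      by (intro tendsto_0_le[OF lim, of _ 1] always_eventually) (auto simp: L2_set_nonneg)
    then show ?thesis by (rule LIM_zero_cancel)
  qed
  with F show ?thesis by (intro that[of F]) auto
qed

section \<open>Flattenings and their Kronecker powers\<close>

definition flattening ::
    "nat list \<Rightarrow> ('i \<Rightarrow> 'i \<Rightarrow> nat list \<Rightarrow> complex) \<Rightarrow> tensor \<Rightarrow> 'i \<Rightarrow> 'i \<Rightarrow> complex" where
  "flattening ds g S i j = (\<Sum>x\<in>tensor_indices ds. g i j x * S x)"

text \<open>
  The \<open>k\<close>-fold Kronecker power of the flattening, where \<open>k\<close> is the common length of the two words. The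
  recursion contracts the leading block of indices, of length \<open>length ds\<close>, with the first letters. The
  second equation matters only for empty words, where the tensor has order \<open>0\<close>.
\<close>

fun flattening_power ::
    "nat list \<Rightarrow> ('i \<Rightarrow> 'i \<Rightarrow> nat list \<Rightarrow> complex) \<Rightarrow> tensor \<Rightarrow> 'i list \<Rightarrow> 'i list \<Rightarrow> complex" where
  "flattening_power ds g S (i # is) (j # js) =
     (\<Sum>x\<in>tensor_indices ds. g i j x * flattening_power ds g (\<lambda>y. S (x @ y)) is js)"
| "flattening_power ds g S _ _ = S []"

lemma flattening_power_zero: "length is = length js \<Longrightarrow> flattening_power ds g (\<lambda>x. 0) is js = 0"
  by (induction "is" js rule: list_induct2) auto

lemma flattening_power_add:
  "length is = length js \<Longrightarrow>
   flattening_power ds g (\<lambda>x. S x + T x) is js =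
     flattening_power ds g S is js + flattening_power ds g T is js"
  by (induction "is" js arbitrary: S T rule: list_induct2) (auto simp: distrib_left sum.distrib)

lemma flattening_power_scale:
  "length is = length js \<Longrightarrow>
   flattening_power ds g (\<lambda>x. c * S x) is js = c * flattening_power ds g S is js"
  by (induction "is" js arbitrary: S rule: list_induct2) (auto simp: sum_distrib_left ac_simps)

lemma flattening_power_sum_pure_tensors:
  assumes "length is = length js"
  shows "flattening_power ds g (sum_pure_tensors vss) is js =
         (\<Sum>vs\<leftarrow>vss. flattening_power ds g (pure_tensor vs) is js)"
proof (induction vss)
  case Nil
  then show ?case using flattening_power_zero[OF assms] by (simp add: sum_pure_tensors_def)
next
  case (Cons vs vss)
  then show ?case
    using flattening_power_add[OF assms, of ds g "pure_tensor vs" "sum_pure_tensors vss"]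
    by (simp add: sum_pure_tensors_def)
qed

text \<open>
  Multiplicativity, the property for which these powers are made. It applies to tensor powers and to
  pure tensors alike.
\<close>

lemma flattening_power_product:
  assumes "length is = length js"
    and "\<And>x y. x \<in> tensor_indices ds \<Longrightarrow> S (x @ y) = T x * R y"
  shows "flattening_power ds g S (i # is) (j # js) =
         flattening ds g T i j * flattening_power ds g R is js"
proof -
  have "flattening_power ds g S (i # is) (j # js) =
        (\<Sum>x\<in>tensor_indices ds. g i j x * flattening_power ds g (\<lambda>y. T x * R y) is js)"
    using assms(2) by (auto intro!: sum.cong)
  then show ?thesis
    by (simp add: flattening_power_scale[OF assms(1)] flattening_def sum_distrib_right mult.assoc)
qed

lemma flattening_power_tensor_power:
  assumes unit: "\<And>i j. i \<in> A \<Longrightarrow> j \<in> A \<Longrightarrow> flattening ds g T i j = (if i = j then 1 else 0)"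
    and "is \<in> words A k" "js \<in> words A k"
  shows "flattening_power ds g (tensor_power ds T k) is js = (if is = js then 1 else 0)"
  using assms(2,3)
proof (induction k arbitrary: "is" js)
  case 0
  then show ?case by (simp add: words_0)
next
  case (Suc k)
  then obtain i is' j js' where w: "is = i # is'" "i \<in> A" "is' \<in> words A k"
    "js = j # js'" "j \<in> A" "js' \<in> words A k"
    by (auto simp: words_Suc)
  have "length is' = length js'" using w by (simp add: words_def)
  moreover have "tensor_power ds T (Suc k) (x @ y) = T x * tensor_power ds T k y"
    if "x \<in> tensor_indices ds" for x y
    using length_tensor_indices[OF that] by (simp add: tensor_product_def)
  ultimately have "flattening_power ds g (tensor_power ds T (Suc k)) (i # is') (j # js') =
      flattening ds g T i j * flattening_power ds g (tensor_power ds T k) is' js'"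
    by (rule flattening_power_product)
  then show ?case using Suc.IH[OF w(3,6)] unit[OF w(2,5)] w by simp
qed

lemma rank_flattening_power_pure_tensor:
  assumes pure: "\<And>us. map dim_vec us = ds \<Longrightarrow> rank_at_most q A (flattening ds g (pure_tensor us))"
    and "map dim_vec vs = power_dims ds k"
  shows "rank_at_most (q ^ k) (words A k) (flattening_power ds g (pure_tensor vs))"
  using assms(2)
proof (induction k arbitrary: vs)
  case 0
  then show ?case
    by (auto simp: rank_at_most_def words_0 intro!: exI[of _ "[(\<lambda>_. pure_tensor vs [], \<lambda>_. 1)]"])
next
  case (Suc k)
  define us ws where "us = take (length ds) vs" and "ws = drop (length ds) vs"
  have vs: "vs = us @ ws" by (simp add: us_def ws_def)
  have us: "map dim_vec us = ds" and ws: "map dim_vec ws = power_dims ds k"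
    using Suc.prems by (simp_all add: us_def ws_def take_map[symmetric] drop_map[symmetric] power_dims_def)
  have len: "length us = length ds" using us by auto
  have "flattening_power ds g (pure_tensor vs) is js =
      flattening ds g (pure_tensor us) (hd is) (hd js) *
      flattening_power ds g (pure_tensor ws) (tl is) (tl js)"
    if "is \<in> words A (Suc k)" "js \<in> words A (Suc k)" for "is" js
  proof -
    from that obtain i is' j js' where w: "is = i # is'" "js = j # js'" "length is' = length js'"
      unfolding words_Suc by (auto simp: words_def)
    have "pure_tensor vs (x @ y) = pure_tensor us x * pure_tensor ws y"
      if "x \<in> tensor_indices ds" for x y
      unfolding vs using length_tensor_indices[OF that] len by (intro pure_tensor_append) simp
    then have "flattening_power ds g (pure_tensor vs) (i # is') (j # js') =
        flattening ds g (pure_tensor us) i j * flattening_power ds g (pure_tensor ws) is' js'"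
      by (rule flattening_power_product[OF w(3)])
    then show ?thesis by (simp add: w)
  qed
  then show ?case
    using rank_at_most_kronecker[OF pure[OF us] Suc.IH[OF ws]] unfolding power_Suc
    by (simp cong: rank_at_most_cong)
qed

text \<open>
  A Kronecker power of a flattening is linear in finitely many coordinates, hence continuous.
\<close>

lemma tendsto_flattening_power:
  assumes "length is = length js"
    and "\<And>x. x \<in> tensor_indices (power_dims ds (length is)) \<Longrightarrow> ((\<lambda>\<epsilon>. F \<epsilon> x) \<longlongrightarrow> T x) L"
  shows "((\<lambda>\<epsilon>. flattening_power ds g (F \<epsilon>) is js) \<longlongrightarrow> flattening_power ds g T is js) L"
  using assms
proof (induction "is" js arbitrary: F T rule: list_induct2)
  case Nil
  then show ?case by (simp add: power_dims_def tensor_indices_Nil)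
next
  case (Cons i "is" j js)
  have "((\<lambda>\<epsilon>. flattening_power ds g (\<lambda>y. F \<epsilon> (x @ y)) is js) \<longlongrightarrow>
         flattening_power ds g (\<lambda>y. T (x @ y)) is js) L" if "x \<in> tensor_indices ds" for x
    using that Cons.prems
    by (intro Cons.IH) (simp add: power_dims_def append_in_tensor_indices length_tensor_indices)
  then show ?case by (auto intro!: tendsto_sum tendsto_mult)
qed

text \<open>
  The tensor power is mapped to an identity matrix of size \<open>card A ^ k\<close>, and a tensor \<open>F \<epsilon>\<close> that is
  close enough to it is mapped to a matrix near this identity, which has full rank. A pure tensor
  contributes at most \<open>q ^ k\<close> to that rank, so \<open>F \<epsilon>\<close> needs many of them.
\<close>

lemma border_rank_tensor_power_ge_of_unit_flattening:
  assumes "ds \<noteq> []" "k \<ge> 1" "finite A" "T \<in> tensor_space ds"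
    and space: "tensor_power ds T k \<in> tensor_space (power_dims ds k)"
    and pure: "\<And>us. map dim_vec us = ds \<Longrightarrow> rank_at_most q A (flattening ds g (pure_tensor us))"
    and unit: "\<And>i j. i \<in> A \<Longrightarrow> j \<in> A \<Longrightarrow> flattening ds g T i j = (if i = j then 1 else 0)"
  shows "card A ^ k \<le> border_rank (power_dims ds k) (tensor_power ds T k) * q ^ k"
proof (cases "A = {}")
  case True
  then show ?thesis using \<open>k \<ge> 1\<close> by (simp add: power_0_left)
next
  case False
  let ?D = "power_dims ds k" and ?P = "tensor_power ds T k" and ?W = "words A k"
  have W: "finite ?W" "card ?W = card A ^ k"
    using \<open>finite A\<close> by (simp_all add: finite_words card_words)
  have "card ?W > 0" using W False \<open>finite A\<close> by (simp add: card_gt_0_iff)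
  obtain F :: "real \<Rightarrow> tensor" where
    F: "\<And>\<epsilon>. \<epsilon> > 0 \<Longrightarrow> F \<epsilon> \<in> tensor_space ?D \<and> tensor_rank ?D (F \<epsilon>) = border_rank ?D ?P"
    and lim: "\<And>x. x \<in> tensor_indices ?D \<Longrightarrow> ((\<lambda>\<epsilon>. F \<epsilon> x) \<longlongrightarrow> ?P x) (at_right 0)"
    using border_rank_approximation[OF space] by blast
  have "((\<lambda>\<epsilon>. flattening_power ds g (F \<epsilon>) is js) \<longlongrightarrow> (if is = js then 1 else 0)) (at_right 0)"
    if "is \<in> ?W" "js \<in> ?W" for "is" js
    using tendsto_flattening_power[of "is" js ds F ?P "at_right 0" g] lim that
      flattening_power_tensor_power[of A ds g T, OF unit that]
    by (auto simp: words_def)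
  from tendstoD[OF this, of _ _ "1 / card ?W"]
  have "\<forall>\<^sub>F \<epsilon> in at_right 0. \<forall>is\<in>?W. \<forall>js\<in>?W.
      cmod (flattening_power ds g (F \<epsilon>) is js - (if is = js then 1 else 0)) < 1 / card ?W"
    using W \<open>card ?W > 0\<close> by (auto simp: eventually_ball_finite_distrib dist_norm)
  moreover have "\<forall>\<^sub>F \<epsilon> in at_right 0. \<epsilon> > (0::real)"
    by (simp add: eventually_at_right_less)
  ultimately have "\<forall>\<^sub>F \<epsilon> in at_right 0. \<epsilon> > (0::real) \<and> (\<forall>is\<in>?W. \<forall>js\<in>?W.
      cmod (flattening_power ds g (F \<epsilon>) is js - (if is = js then 1 else 0)) < 1 / card ?W)"
    by eventually_elim auto
  then obtain \<epsilon> :: real where "\<epsilon> > 0" and close: "\<And>is js. is \<in> ?W \<Longrightarrow> js \<in> ?W \<Longrightarrow>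
      cmod (flattening_power ds g (F \<epsilon>) is js - (if is = js then 1 else 0)) < 1 / card ?W"
    using eventually_happens'[OF trivial_limit_at_right_real] by blast
  have "?D \<noteq> []" using \<open>ds \<noteq> []\<close> \<open>k \<ge> 1\<close> by (cases k) (simp_all add: power_dims_def)
  then have "has_decomposition ?D (F \<epsilon>) (border_rank ?D ?P)"
    using tensor_rank_decomposition F[OF \<open>\<epsilon> > 0\<close>] by metis
  then obtain vss where vss: "length vss = border_rank ?D ?P" "F \<epsilon> = sum_pure_tensors vss"
    and dims: "\<And>vs. vs \<in> set vss \<Longrightarrow> map dim_vec vs = ?D"
    unfolding has_decomposition_def by blast
  have "rank_at_most (length vss * q ^ k) ?W
      (\<lambda>is js. \<Sum>vs\<leftarrow>vss. flattening_power ds g (pure_tensor vs) is js)"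
    using rank_flattening_power_pure_tensor[OF pure dims] by (intro rank_at_most_sum_list) auto
  then have "rank_at_most (length vss * q ^ k) ?W (flattening_power ds g (F \<epsilon>))"
    unfolding vss(2) by (subst rank_at_most_cong[OF flattening_power_sum_pure_tensors])
      (auto simp: words_def)
  from rank_near_identity[OF W(1) this close] show ?thesis using W vss by simp
qed

lemma flattening_mult_left:
  "flattening ds (\<lambda>i j x. \<Sum>l\<in>A. c i l * g l j x) S i j = (\<Sum>l\<in>A. c i l * flattening ds g S l j)"
  unfolding flattening_def sum_distrib_left sum_distrib_right
  by (subst sum.swap) (simp add: ac_simps)

text \<open>
  An invertible matrix can replace the identity: multiplication by its inverse from the left
  is again a flattening, and does not increase the rank of the images of pure tensors.
\<close>

proposition border_rank_tensor_power_ge: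
  assumes "ds \<noteq> []" "k \<ge> 1" "T \<in> tensor_space ds"
    and space: "tensor_power ds T k \<in> tensor_space (power_dims ds k)"
    and pure: "\<And>us. map dim_vec us = ds \<Longrightarrow> rank_at_most q {..<N} (flattening ds g (pure_tensor us))"
    and det: "det (mat N N (\<lambda>(i, j). flattening ds g T i j)) \<noteq> 0"
  shows "N ^ k \<le> border_rank (power_dims ds k) (tensor_power ds T k) * q ^ k"
proof -
  let ?M = "mat N N (\<lambda>(i, j). flattening ds g T i j)"
  obtain B where B: "B \<in> carrier_mat N N" "B * ?M = 1\<^sub>m N"
    using det_non_zero_imp_unit[of ?M N "()"] det
    by (auto simp: Units_def ring_mat_def)
  let ?h = "\<lambda>i j x. \<Sum>l<N. B $$ (i, l) * g l j x"
  have "flattening ds ?h T i j = (if i = j then 1 else 0)" if "i \<in> {..<N}" "j \<in> {..<N}" for i j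
  proof -
    have "flattening ds ?h T i j = (B * ?M) $$ (i, j)"
      using B(1) that
      by (simp add: flattening_mult_left scalar_prod_def atLeast0LessThan)
    then show ?thesis using B(2) that by simp
  qed
  moreover have "rank_at_most q {..<N} (flattening ds ?h (pure_tensor us))" if "map dim_vec us = ds" for us
    using rank_at_most_mult_left[OF pure[OF that], of "\<lambda>i l. B $$ (i, l)"]
    by (subst rank_at_most_cong[OF flattening_mult_left]) simp
  ultimately show ?thesis
    using border_rank_tensor_power_ge_of_unit_flattening[of ds k "{..<N}" T q ?h] assms(1-4) by simp
qed

section \<open>The Koszul flattening\<close>

text \<open>
  On indices in \<open>{0, 1, 2}\<close> this product takes the values \<open>1\<close>, \<open>-1\<close> and \<open>0\<close> of the sign of
  the permutation \<open>(s, t, a)\<close>. Thus \<open>\<Sum>a<3. levi_civita s t a * u a\<close> are the entries of the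
  skew matrix \<open>K(u)\<close>.
\<close>

definition levi_civita :: "nat \<Rightarrow> nat \<Rightarrow> nat \<Rightarrow> complex" where
  "levi_civita s t a =
     (of_nat s - of_nat t) * (of_nat t - of_nat a) * (of_nat a - of_nat s) / 2"

text \<open>
  A row \<open>i = s * m + b\<close> stands for the pair of a row \<open>s\<close> of \<open>K(u)\<close> and a coordinate \<open>b\<close> of the second
  factor. A column stands in the same way for a column of \<open>K(u)\<close> and a coordinate of the third factor.
  The indices below \<open>2 * m + 2\<close> are therefore all pairs with \<open>s < 2\<close>, together with \<open>(2, 0)\<close> and \<open>(2, 1)\<close>.
\<close>

definition koszul_coeff :: "nat \<Rightarrow> nat \<Rightarrow> nat \<Rightarrow> nat list \<Rightarrow> complex" where
  "koszul_coeff m i j x =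
     (if x ! 0 < 3 \<and> x ! 1 = i mod m \<and> x ! 2 = j mod m
      then levi_civita (i div m) (j div m) (x ! 0) else 0)"

lemma flattening_koszul:
  assumes "m \<ge> 3"
  shows "flattening [m, m, m] (koszul_coeff m) S i j =
         (\<Sum>a<3. levi_civita (i div m) (j div m) a * S [a, i mod m, j mod m])"
proof -
  let ?X = "(\<lambda>a. [a, i mod m, j mod m]) ` {..<3}"
  have "flattening [m, m, m] (koszul_coeff m) S i j = (\<Sum>x\<in>?X. koszul_coeff m i j x * S x)"
    unfolding flattening_def using assms
    by (intro sum.mono_neutral_right finite_tensor_indices)
       (auto simp: tensor_indices_Cons tensor_indices_Nil koszul_coeff_def image_iff)
  also have "\<dots> = (\<Sum>a<3. levi_civita (i div m) (j div m) a * S [a, i mod m, j mod m])"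
    by (subst sum.reindex) (auto simp: inj_on_def koszul_coeff_def intro!: sum.cong)
  finally show ?thesis .
qed

lemma sum_lessThan_3: "(\<Sum>a<3::nat. f a) = f 0 + f 1 + f 2"
  by (simp add: eval_nat_numeral)

text \<open>
  The cross product of \<open>u\<close> with itself is zero, which is a relation between the rows of \<open>K(u)\<close> with
  coefficients \<open>u\<close>. It is a nontrivial relation unless \<open>u = 0\<close>, and then \<open>K(u) = 0\<close>.
\<close>

lemma rank_cross_product_matrix:
  fixes u :: "nat \<Rightarrow> complex"
  shows "rank_at_most 2 {..<3} (\<lambda>s t. \<Sum>a<3. levi_civita s t a * u a)"
proof -
  have self: "(\<Sum>s<3. u s * (\<Sum>a<3. levi_civita s t a * u a)) = 0" if "t < 3" for t
  proof -
    from that have "t = 0 \<or> t = 1 \<or> t = 2" by auto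
    then show ?thesis by (auto simp: sum_lessThan_3 levi_civita_def)
  qed
  show ?thesis
  proof (cases "\<exists>r<3. u r \<noteq> 0")
    case True
    then obtain r where "r < 3" "u r \<noteq> 0" by auto
    then show ?thesis
      using rank_at_most_row_relation[of "{..<3}" r u "\<lambda>s t. \<Sum>a<3. levi_civita s t a * u a"] self
      by simp
  next
    case False
    then show ?thesis
      using rank_at_most_row_relation[of "{..<3}" 0 "\<lambda>_. 1" "\<lambda>s t. \<Sum>a<3. levi_civita s t a * u a"]
      by simp
  qed
qed

lemma pure_tensor3:
  assumes "u \<in> carrier_vec m" "v \<in> carrier_vec m" "w \<in> carrier_vec m" "a < m" "b < m" "c < m"
  shows "pure_tensor [u, v, w] [a, b, c] = u $ a * v $ b * w $ c"
  using assms by (auto simp: pure_tensor_def tensor_indices_def eval_nat_numeral)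

lemma rank_koszul_flattening_pure_tensor:
  assumes "m \<ge> 3" "map dim_vec us = [m, m, m]"
  shows "rank_at_most 2 {..<2 * m + 2} (flattening [m, m, m] (koszul_coeff m) (pure_tensor us))"
proof -
  obtain u v w where us: "us = [u, v, w]" "u \<in> carrier_vec m" "v \<in> carrier_vec m" "w \<in> carrier_vec m"
  proof -
    have "length us = 3" using arg_cong[OF assms(2), of length] by simp
    then obtain u v w where "us = [u, v, w]" by (auto simp: length_Suc_conv eval_nat_numeral)
    then show ?thesis using assms(2) by (intro that[of u v w]) (auto intro: carrier_vecI)
  qed
  obtain pqs where len: "length pqs = 2" and
    K: "\<And>s t. s < 3 \<Longrightarrow> t < 3 \<Longrightarrow>
          (\<Sum>a<3. levi_civita s t a * u $ a) = (\<Sum>(p, q)\<leftarrow>pqs. p s * q t)"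
    using rank_cross_product_matrix[of "\<lambda>a. u $ a"] unfolding rank_at_most_def lessThan_iff by blast
  let ?rs = "map (\<lambda>(p, q). (\<lambda>i. p (i div m) * v $ (i mod m), \<lambda>j. q (j div m) * w $ (j mod m))) pqs"
  have "flattening [m, m, m] (koszul_coeff m) (pure_tensor us) i j = (\<Sum>(p, q)\<leftarrow>?rs. p i * q j)"
    if "i < 2 * m + 2" "j < 2 * m + 2" for i j
  proof -
    have "i div m < 3" "j div m < 3" "i mod m < m" "j mod m < m"
      using assms(1) that by (auto simp: less_mult_imp_div_less)
    have "flattening [m, m, m] (koszul_coeff m) (pure_tensor us) i j =
        (\<Sum>a<3. levi_civita (i div m) (j div m) a * (u $ a * v $ (i mod m) * w $ (j mod m)))"
      unfolding flattening_koszul[OF assms(1)] us(1) using us assms(1)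
      by (intro sum.cong refl) (simp add: pure_tensor3)
    also have "\<dots> = (\<Sum>a<3. levi_civita (i div m) (j div m) a * u $ a) * (v $ (i mod m) * w $ (j mod m))"
      by (simp add: sum_distrib_right mult.assoc)
    also have "\<dots> = (\<Sum>(p, q)\<leftarrow>pqs. p (i div m) * q (j div m)) * (v $ (i mod m) * w $ (j mod m))"
      using K[OF \<open>i div m < 3\<close> \<open>j div m < 3\<close>] by simp
    also have "\<dots> = (\<Sum>(p, q)\<leftarrow>?rs. p i * q j)"
      by (induction pqs) (auto simp: algebra_simps)
    finally show ?thesis .
  qed
  then show ?thesis unfolding rank_at_most_def using len by (intro exI[of _ ?rs]) auto
qed

section \<open>The minor as a polynomial\<close>

lemma polynomial_map_sum:
  assumes "finite A" "\<And>i. i \<in> A \<Longrightarrow> polynomial_map m r (f i)"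
  shows "polynomial_map m r (\<lambda>ps. \<Sum>i\<in>A. f i ps)"
  using assms
  by (induction A rule: finite_induct)
     (simp_all add: polynomial_map.const polynomial_map.add polynomial_map.mult)

lemma polynomial_map_prod:
  assumes "finite A" "\<And>i. i \<in> A \<Longrightarrow> polynomial_map m r (f i)"
  shows "polynomial_map m r (\<lambda>ps. \<Prod>i\<in>A. f i ps)"
  using assms
  by (induction A rule: finite_induct)
     (simp_all add: polynomial_map.const polynomial_map.add polynomial_map.mult)

lemma polynomial_map_det:
  assumes "\<And>i j. i < N \<Longrightarrow> j < N \<Longrightarrow> polynomial_map m r (f i j)"
  shows "polynomial_map m r (\<lambda>ps. det (mat N N (\<lambda>(i, j). f i j ps)))"
proof -
  have "det (mat N N (\<lambda>(i, j). f i j ps)) =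
        (\<Sum>p\<in>{p. p permutes {0..<N}}. signof p * (\<Prod>i=0..<N. f i (p i) ps))" for ps
    by (subst det_def') (auto intro!: sum.cong prod.cong)
  moreover have "polynomial_map m r
        (\<lambda>ps. \<Sum>p\<in>{p. p permutes {0..<N}}. signof p * (\<Prod>i=0..<N. f i (p i) ps))"
  proof (intro polynomial_map_sum polynomial_map.mult polynomial_map.const polynomial_map_prod)
    fix p i assume "p \<in> {p. p permutes {0..<N}}" "i \<in> {0..<N}"
    then show "polynomial_map m r (f i (p i))" using assms by (simp add: permutes_in_image)
  qed (simp_all add: finite_permutations)
  ultimately show ?thesis by simp
qed

text \<open>
  On the parameter space this is a coordinate of \<open>tensor_of_params ps\<close>. That function itself is not
  suited for \<open>polynomial_map\<close>, which compares functions on all lists: its value depends on the length of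
  \<open>ps\<close> and on the dimensions of the vectors.
\<close>

definition tensor_coordinate :: "nat \<Rightarrow> nat \<Rightarrow> nat \<Rightarrow> nat \<Rightarrow> vec_triple list \<Rightarrow> complex" where
  "tensor_coordinate r a b c ps =
     (\<Sum>l<r. fst (ps ! l) $ a * fst (snd (ps ! l)) $ b * snd (snd (ps ! l)) $ c)"

lemma polynomial_map_tensor_coordinate:
  "a < m \<Longrightarrow> b < m \<Longrightarrow> c < m \<Longrightarrow> polynomial_map m r (tensor_coordinate r a b c)"
  unfolding tensor_coordinate_def
  by (intro polynomial_map_sum polynomial_map.intros) auto

lemma param_spaceD:
  assumes "ps \<in> param_space m r" "l < r"
  shows "fst (ps ! l) \<in> carrier_vec m" "fst (snd (ps ! l)) \<in> carrier_vec m"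
    "snd (snd (ps ! l)) \<in> carrier_vec m"
proof -
  have "ps ! l \<in> carrier_vec m \<times> carrier_vec m \<times> carrier_vec m"
    using assms by (auto simp: param_space_def)
  then show "fst (ps ! l) \<in> carrier_vec m" "fst (snd (ps ! l)) \<in> carrier_vec m"
    "snd (snd (ps ! l)) \<in> carrier_vec m"
    by auto
qed

lemma tensor_of_params_coordinate:
  assumes "ps \<in> param_space m r" "a < m" "b < m" "c < m"
  shows "tensor_of_params ps [a, b, c] = tensor_coordinate r a b c ps"
proof -
  have "length ps = r" using assms(1) by (simp add: param_space_def)
  have "tensor_of_params ps [a, b, c] =
        (\<Sum>l<r. pure_tensor [fst (ps ! l), fst (snd (ps ! l)), snd (snd (ps ! l))] [a, b, c])"
    using \<open>length ps = r\<close>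
    by (simp add: tensor_of_params_def sum_pure_tensors_def sum_list_sum_nth atLeast0LessThan case_prod_unfold)
  also have "\<dots> = tensor_coordinate r a b c ps"
    unfolding tensor_coordinate_def using param_spaceD[OF assms(1)] assms(2-4)
    by (intro sum.cong refl pure_tensor3) auto
  finally show ?thesis .
qed

lemma has_decomposition_tensor_of_params:
  assumes "ps \<in> param_space m r"
  shows "has_decomposition [m, m, m] (tensor_of_params ps) r"
proof -
  have "map dim_vec [u, v, w] = [m, m, m]" if "(u, v, w) \<in> set ps" for u v w
  proof -
    have "(u, v, w) \<in> carrier_vec m \<times> carrier_vec m \<times> carrier_vec m"
      using assms that unfolding param_space_def by blast
    then show ?thesis by simp
  qed
  moreover have "length ps = r" using assms by (simp add: param_space_def)
  ultimately show ?thesis unfolding has_decomposition_def tensor_of_params_def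
    by (intro exI[of _ "map (\<lambda>(u, v, w). [u, v, w]) ps"]) force
qed

definition koszul_minor :: "nat \<Rightarrow> nat \<Rightarrow> vec_triple list \<Rightarrow> complex" where
  "koszul_minor m r ps = det (mat (2 * m + 2) (2 * m + 2)
     (\<lambda>(i, j). \<Sum>a<3. levi_civita (i div m) (j div m) a * tensor_coordinate r a (i mod m) (j mod m) ps))"

lemma polynomial_map_koszul_minor:
  assumes "m \<ge> 3"
  shows "polynomial_map m r (koszul_minor m r)"
  unfolding koszul_minor_def
proof (rule polynomial_map_det, rule polynomial_map_sum)
  fix i j a :: nat
  assume "a \<in> {..<3}"
  then show "polynomial_map m r (\<lambda>ps. levi_civita (i div m) (j div m) a *
      tensor_coordinate r a (i mod m) (j mod m) ps)"
    using assms by (intro polynomial_map.mult polynomial_map.const polynomial_map_tensor_coordinate) auto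
qed simp

lemma koszul_minor_eq:
  assumes "m \<ge> 3" "ps \<in> param_space m r"
  shows "koszul_minor m r ps = det (mat (2 * m + 2) (2 * m + 2)
           (\<lambda>(i, j). flattening [m, m, m] (koszul_coeff m) (tensor_of_params ps) i j))"
proof -
  have "flattening [m, m, m] (koszul_coeff m) (tensor_of_params ps) i j =
      (\<Sum>a<3. levi_civita (i div m) (j div m) a * tensor_coordinate r a (i mod m) (j mod m) ps)" for i j
    unfolding flattening_koszul[OF assms(1)]
    using assms by (intro sum.cong refl) (simp add: tensor_of_params_coordinate)
  then show ?thesis by (simp add: koszul_minor_def)
qed

section \<open>A point where the minor does not vanish\<close>

text \<open>
  In coordinates, the flattening of \<open>\<Sum>\<^sub>l u\<^sub>l \<otimes> e\<^sub>l \<otimes> e\<^sub>l\<close> is block diagonal with blocks \<open>K(u\<^sub>l)\<close>, each of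
  rank \<open>2\<close>, which gives rank \<open>2 * m\<close>. The last summand couples the blocks of \<open>e\<^sub>0\<close> and \<open>e\<^sub>1\<close>. As \<open>u\<^sub>0, u\<^sub>1\<close>
  and its first vector are linearly independent, it makes the common \<open>6 \<times> 6\<close> block invertible. In
  the other blocks the choice \<open>u\<^sub>l = e\<^sub>2\<close> puts the nonzero \<open>2 \<times> 2\<close> minor in the rows and columns \<open>0\<close> and \<open>1\<close>,
  as the index set \<open>{..<2 * m + 2}\<close> requires.
\<close>

definition special_params :: "nat \<Rightarrow> vec_triple list" where
  "special_params m =
     map (\<lambda>l. (unit_vec m (min l 2), unit_vec m l, unit_vec m l)) [0..<m] @
     [(unit_vec m 2, unit_vec m 0 + unit_vec m 1, unit_vec m 0 + unit_vec m 1)]"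

lemma special_params_in_param_space: "special_params m \<in> param_space m (m + 1)"
  by (auto simp: special_params_def param_space_def)

lemma tensor_coordinate_special_params:
  assumes "m \<ge> 3" "a < 3" "b < m" "c < m"
  shows "tensor_coordinate (m + 1) a b c (special_params m) =
         (if b = c \<and> a = min b 2 then 1 else 0) + (if a = 2 \<and> b < 2 \<and> c < 2 then 1 else 0)"
proof -
  let ?t = "\<lambda>l. fst (special_params m ! l) $ a * fst (snd (special_params m ! l)) $ b *
                snd (snd (special_params m ! l)) $ c"
  have "(\<Sum>l<m. ?t l) = (\<Sum>l<m. if l = b then (if b = c \<and> a = min b 2 then 1 else 0) else 0)"
    using assms by (intro sum.cong) (auto simp: special_params_def nth_append unit_vec_def)
  also have "\<dots> = (if b = c \<and> a = min b 2 then 1 else 0)" using assms by simp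
  finally have 1: "(\<Sum>l<m. ?t l) = (if b = c \<and> a = min b 2 then 1 else 0)" .
  have "special_params m ! m = (unit_vec m 2, unit_vec m 0 + unit_vec m 1, unit_vec m 0 + unit_vec m 1)"
    by (simp add: special_params_def nth_append)
  then have "?t m = (if a = 2 \<and> b < 2 \<and> c < 2 then 1 else 0)"
    using assms by (auto simp: unit_vec_def less_2_cases_iff)
  with 1 show ?thesis by (simp add: tensor_coordinate_def)
qed

lemma sum_split_blocks:
  fixes f :: "nat \<Rightarrow> complex"
  shows "(\<Sum>j<2 * m + 2. f j) = (\<Sum>c<m. f c) + (\<Sum>c<m. f (m + c)) + f (2 * m) + f (2 * m + 1)"
proof -
  have "(\<Sum>j<m + n. f j) = (\<Sum>c<m. f c) + (\<Sum>c<n. f (m + c))" for n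
    by (induction n) simp_all
  then show ?thesis by (simp add: mult_2)
qed

text \<open>
  The kernel of the matrix is trivial. A kernel vector splits into the coordinates \<open>x t c\<close>. For
  \<open>b \<ge> 2\<close> the rows \<open>(0, b)\<close> and \<open>(1, b)\<close> involve a single coordinate each, and the six rows \<open>(s, 0)\<close> and
  \<open>(s, 1)\<close> form a system for the six remaining coordinates that is solved by substitution.
\<close>

lemma koszul_minor_special_params:
  assumes "m \<ge> 3"
  shows "koszul_minor m (m + 1) (special_params m) \<noteq> 0"
proof
  define M where "M = (\<lambda>i j. \<Sum>a<3. levi_civita (i div m) (j div m) a *
      tensor_coordinate (m + 1) a (i mod m) (j mod m) (special_params m))"
  let ?N = "2 * m + 2"
  assume "koszul_minor m (m + 1) (special_params m) = 0"
  then have "det (mat ?N ?N (\<lambda>(i, j). M i j)) = 0" by (simp add: koszul_minor_def M_def)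
  then obtain v where v: "v \<in> carrier_vec ?N" "v \<noteq> 0\<^sub>v ?N"
    and Mv: "mat ?N ?N (\<lambda>(i, j). M i j) *\<^sub>v v = 0\<^sub>v ?N"
    using det_0_iff_vec_prod_zero_field[of "mat ?N ?N (\<lambda>(i, j). M i j)" ?N] by auto
  define x where "x t c = v $ (t * m + c)" for t c
  have M: "M (s * m + b) (t * m + c) =
      (if c = b then levi_civita s t (min b 2) else 0) +
      (if c < 2 \<and> b < 2 then levi_civita s t 2 else 0)" if "b < m" "c < m" for s t b c
  proof -
    have divmod: "(s * m + b) div m = s" "(s * m + b) mod m = b"
      "(t * m + c) div m = t" "(t * m + c) mod m = c"
      using that by simp_all
    have "M (s * m + b) (t * m + c) = (\<Sum>a<3. levi_civita s t a *
      ((if b = c \<and> a = min b 2 then 1 else 0) + (if a = 2 \<and> b < 2 \<and> c < 2 then 1 else 0)))"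
      unfolding M_def divmod
      by (intro sum.cong refl)
         (simp only: lessThan_iff tensor_coordinate_special_params[OF assms _ that])
    also have "\<dots> = (\<Sum>a<3. (if a = min b 2 then if c = b then levi_civita s t (min b 2) else 0 else 0)) +
      (\<Sum>a<3::nat. if a = 2 then if c < 2 \<and> b < 2 then levi_civita s t 2 else 0 else 0)"
      unfolding sum.distrib[symmetric] by (intro sum.cong) auto
    finally show ?thesis by (simp add: min_less_iff_disj)
  qed
  have block: "(\<Sum>c<m. M (s * m + b) (t * m + c) * y c) =
      levi_civita s t (min b 2) * y b + (if b < 2 then levi_civita s t 2 * (y 0 + y 1) else 0)"
    if "b < m" for s t b y
  proof -
    have "(\<Sum>c<m. M (s * m + b) (t * m + c) * y c) =
        (\<Sum>c<m. if c = b then levi_civita s t (min b 2) * y b else 0) +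
        (\<Sum>c<m. if c = 0 then if b < 2 then levi_civita s t 2 * y 0 else 0 else 0) +
        (\<Sum>c<m. if c = 1 then if b < 2 then levi_civita s t 2 * y 1 else 0 else 0)"
      unfolding sum.distrib[symmetric] using that
      by (intro sum.cong) (auto simp: M less_2_cases_iff distrib_right)
    also have "\<dots> = levi_civita s t (min b 2) * y b + (if b < 2 then levi_civita s t 2 * (y 0 + y 1) else 0)"
      using that assms by (simp add: distrib_left)
    finally show ?thesis .
  qed
  have eq: "levi_civita s 0 (min b 2) * x 0 b + levi_civita s 1 (min b 2) * x 1 b +
      (if b < 2 then levi_civita s 0 2 * (x 0 0 + x 0 1) + levi_civita s 1 2 * (x 1 0 + x 1 1) +
         levi_civita s 2 b * x 2 b + levi_civita s 2 2 * (x 2 0 + x 2 1) else 0) = 0"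
    if "s * m + b < ?N" "b < m" for s b
  proof -
    have "(mat ?N ?N (\<lambda>(i, j). M i j) *\<^sub>v v) $ (s * m + b) = (\<Sum>j<?N. M (s * m + b) j * v $ j)"
      using that v(1) by (simp add: scalar_prod_def atLeast0LessThan)
    then have "0 = (\<Sum>j<?N. M (s * m + b) j * v $ j)"
      using that by (simp only: Mv index_zero_vec)
    also have "\<dots> = (\<Sum>c<m. M (s * m + b) (0 * m + c) * x 0 c) + (\<Sum>c<m. M (s * m + b) (1 * m + c) * x 1 c) +
        M (s * m + b) (2 * m + 0) * x 2 0 + M (s * m + b) (2 * m + 1) * x 2 1"
      unfolding sum_split_blocks by (simp add: x_def)
    also have "\<dots> = levi_civita s 0 (min b 2) * x 0 b + levi_civita s 1 (min b 2) * x 1 b +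
      (if b < 2 then levi_civita s 0 2 * (x 0 0 + x 0 1) + levi_civita s 1 2 * (x 1 0 + x 1 1) +
         levi_civita s 2 b * x 2 b + levi_civita s 2 2 * (x 2 0 + x 2 1) else 0)"
    proof -
      have "0 < m" "1 < m" using assms by simp_all
      then show ?thesis
        unfolding block[OF that(2)] M[OF that(2) \<open>0 < m\<close>] M[OF that(2) \<open>1 < m\<close>] using that(2) assms
        by (auto simp: less_2_cases_iff algebra_simps)
    qed
    finally show ?thesis by simp
  qed
  \<comment> \<open>the coordinates outside the \<open>6 \<times> 6\<close> block\<close>
  have high: "x 0 b = 0" "x 1 b = 0" if "2 \<le> b" "b < m" for b
    using eq[of 1 b] eq[of 0 b] that by (simp_all add: levi_civita_def)
  have "x 1 0 + x 1 1 = 0" "x 2 0 = x 0 0 + x 0 1" "x 1 0 = 0"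
    using eq[of 0 0] eq[of 1 0] eq[of 2 0] assms by (simp_all add: levi_civita_def algebra_simps)
  moreover have "x 2 1 = x 1 0 + x 1 1" "x 0 0 + x 0 1 = 0" "x 0 1 = 0"
    using eq[of 0 1] eq[of 1 1] eq[of 2 1] assms by (simp_all add: levi_civita_def algebra_simps)
  ultimately have low: "x t 0 = 0 \<and> x t 1 = 0" if "t < 3" for t
    using that by (auto simp: eval_nat_numeral less_Suc_eq)
  have "v $ i = 0" if "i < ?N" for i
  proof -
    have i: "v $ i = x (i div m) (i mod m)" by (simp add: x_def)
    have "i div m < 3" "i mod m < m" using assms that by (auto simp: less_mult_imp_div_less)
    show ?thesis
    proof (cases "i mod m < 2")
      case True
      then show ?thesis using low[OF \<open>i div m < 3\<close>] i by (auto simp: less_2_cases_iff)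
    next
      case False
      have "i div m < 2"
      proof (rule ccontr)
        assume "\<not> i div m < 2"
        then have "2 * m \<le> i div m * m" by simp
        moreover have "i div m * m + i mod m = i" by simp
        ultimately show False using False that by linarith
      qed
      then show ?thesis using high[of "i mod m"] False \<open>i mod m < m\<close> i by (auto simp: less_2_cases_iff)
    qed
  qed
  then have "v = 0\<^sub>v ?N" using v(1) by (intro eq_vecI) auto
  with v(2) show False by contradiction
qed

section \<open>Generic tensors of rank m + 1\<close>

lemma border_rank_tensor_power_of_koszul_minor:
  assumes "m \<ge> 3" "ps \<in> param_space m (m + 1)" "koszul_minor m (m + 1) ps \<noteq> 0" "k \<ge> 1"
  defines "T \<equiv> tensor_of_params ps"
  shows "border_rank (power_dims [m, m, m] k) (tensor_power [m, m, m] T k) = (m + 1) ^ k"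
    and "tensor_rank (power_dims [m, m, m] k) (tensor_power [m, m, m] T k) = (m + 1) ^ k"
proof -
  let ?D = "power_dims [m, m, m] k" and ?P = "tensor_power [m, m, m] T k"
  have dec: "has_decomposition [m, m, m] T (m + 1)"
    unfolding T_def by (rule has_decomposition_tensor_of_params[OF assms(2)])
  note decs = has_decomposition_power[OF dec, of k]
  have "(2 * m + 2) ^ k \<le> border_rank ?D ?P * 2 ^ k"
  proof (rule border_rank_tensor_power_ge)
    show "det (mat (2 * m + 2) (2 * m + 2) (\<lambda>(i, j). flattening [m, m, m] (koszul_coeff m) T i j)) \<noteq> 0"
      using assms(3) koszul_minor_eq[OF assms(1,2)] by (simp add: T_def)
  qed (use assms(1,4) rank_koszul_flattening_pure_tensor has_decomposition_in_space[OF dec]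
         has_decomposition_in_space[OF decs] in auto)
  moreover have "(2 * m + 2) ^ k = (m + 1) ^ k * 2 ^ k"
    unfolding power_mult_distrib[symmetric] by (simp add: algebra_simps)
  ultimately have "(m + 1) ^ k \<le> border_rank ?D ?P" by simp
  moreover have "border_rank ?D ?P \<le> tensor_rank ?D ?P"
    by (rule border_rank_le_tensor_rank[OF has_decomposition_in_space[OF decs]])
  moreover have "tensor_rank ?D ?P \<le> (m + 1) ^ k" by (rule tensor_rank_le[OF decs])
  ultimately show "border_rank ?D ?P = (m + 1) ^ k" "tensor_rank ?D ?P = (m + 1) ^ k"
    by simp_all
qed

theorem proposition6p4:
  fixes m :: nat
  assumes "m \<ge> 3"
  shows "\<exists>U. zariski_open m (m + 1) U \<and> U \<noteq> {} \<and>
           (\<forall>ps\<in>U.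
              (\<forall>k\<ge>1. border_rank (power_dims [m, m, m] k)
                         (tensor_power [m, m, m] (tensor_of_params ps) k)
                       = border_rank [m, m, m] (tensor_of_params ps) ^ k) \<and>
              has_tensor_asymptotic_rank [m, m, m] (tensor_of_params ps) (real (m + 1)))"
proof (intro exI conjI ballI)
  let ?U = "{ps \<in> param_space m (m + 1). \<exists>f\<in>{koszul_minor m (m + 1)}. f ps \<noteq> 0}"
  show "zariski_open m (m + 1) ?U"
    unfolding zariski_open_def
    by (rule exI[of _ "{koszul_minor m (m + 1)}"]) (simp add: polynomial_map_koszul_minor[OF assms])
  show "?U \<noteq> {}"
    using special_params_in_param_space koszul_minor_special_params[OF assms] by blast
  fix ps assume "ps \<in> ?U"
  then have ps: "ps \<in> param_space m (m + 1)" "koszul_minor m (m + 1) ps \<noteq> 0" by auto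
  let ?T = "tensor_of_params ps"
  note ranks = border_rank_tensor_power_of_koszul_minor[OF assms ps]
  have "?T \<in> tensor_space [m, m, m]"
    using has_decomposition_in_space has_decomposition_tensor_of_params[OF ps(1)] by blast
  moreover have "power_dims [m, m, m] 1 = [m, m, m]" by (simp add: power_dims_def)
  ultimately have "border_rank [m, m, m] ?T = m + 1"
    using ranks(1)[of 1] tensor_power_1 by (metis order_refl power_one_right)
  then show "\<forall>k\<ge>1. border_rank (power_dims [m, m, m] k) (tensor_power [m, m, m] ?T k)
               = border_rank [m, m, m] ?T ^ k"
    using ranks(1) by simp
  have "\<forall>\<^sub>F k in sequentially. real (m + 1) =
      root k (real (tensor_rank (power_dims [m, m, m] k) (tensor_power [m, m, m] ?T k)))"
    using eventually_ge_at_top[of 1]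
  proof eventually_elim
    case (elim k)
    then have "root k (real (m + 1) ^ k) = real (m + 1)" by (intro real_root_power_cancel) auto
    then show ?case using ranks(2)[OF elim] by simp
  qed
  then show "has_tensor_asymptotic_rank [m, m, m] ?T (real (m + 1))"
    unfolding has_tensor_asymptotic_rank_def by (rule tendsto_eventually[OF eventually_mono]) simp
qed

end
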